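(* Let $\alpha=m/n$ with $m,n$ relatively prime odd positive integers, let $\sigma\ge 0$ be an integer, let $\zeta_0$ be an integer, and let $\{r(\zeta)\}_{\zeta=\zeta_0}^{\infty}$, $\{q(\zeta)\}_{\zeta=\zeta_0}^{\infty}$ be real sequences such that $r(\zeta)>0$ for all $\zeta\ge\zeta_0$, $q(\zeta)\ge 0$ for all $\zeta\ge\zeta_0$, $q(\zeta)\neq 0$ for infinitely many $\zeta$, and $$\sum_{s=\zeta_0}^{\infty}\frac{1}{r^{1/\alpha}(s)}<\infty .$$ If $$\sum_{\zeta=\zeta_0}^{\infty}\left(\frac{1}{r(\zeta)}\sum_{s=\zeta_0}^{\zeta-1}q(s)\right)^{1/\alpha}=\infty,$$ then every solution $\{x(\zeta)\}$ of $$\Delta\big(r(\zeta)(\Delta x(\zeta))^{\alpha}\big)+q(\zeta)\,x^{\alpha}(\zeta-\sigma)=0,\qquad \zeta\ge\zeta_0,$$ either oscillates or satisfies $\lim_{\zeta\to\infty}x(\zeta)=0$.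
   Context: The variable $\zeta$ ranges over integers, and $\Delta x(\zeta)=x(\zeta+1)-x(\zeta)$ is the forward difference operator. For a sequence $f$, $f^{p}(\zeta)$ means $(f(\zeta))^{p}$. Since $\alpha$ is a quotient of odd positive integers, $t\mapsto t^{\alpha}$ and $t\mapsto t^{1/\alpha}$ are the real odd power functions on all of $\mathbb{R}$. Empty sums are $0$. A solution of the equation is a non-trivial real sequence $\{x(\zeta)\}$ defined for $\zeta\ge\zeta_0-\sigma$ that satisfies the equation for all $\zeta\ge\zeta_0$. A solution oscillates if it is neither eventually positive nor eventually negative. *)

theory Defs
  imports Complex_Main
begin

definition fdiff :: "(int \<Rightarrow> real) \<Rightarrow> int \<Rightarrow> real" (\<open>\<Delta>\<close>)
  where "\<Delta> x = (\<lambda>\<zeta>. x (\<zeta> + 1) - x \<zeta>)"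

(* The real power t^(m/n) for odd m and n, defined for every real t. For odd n,
   root n is the inverse of the n-th power on all of the reals; powr would not
   do, since it is not meant for negative bases. With alpha = m/n, the powers
   t^alpha and t^(1/alpha) are odd_pow m n t and odd_pow n m t. *)
definition odd_pow :: "nat \<Rightarrow> nat \<Rightarrow> real \<Rightarrow> real"
  where "odd_pow m n t = root n (t ^ m)"

lemma odd_pow_eq_powr:
  assumes "odd m" "odd n"
  shows "odd_pow m n t = sgn t * \<bar>t\<bar> powr (real m / real n)"
proof -
  have n: "n > 0" and m: "m > 0" using assms odd_pos by auto
  have pos: "root n (s ^ m) = s powr (real m / real n)" if "s > 0" for s :: real
    using that n by (simp add: root_powr_inverse powr_powr flip: powr_realpow)
  show ?thesis
  proof (cases t "0::real" rule: linorder_cases)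
    case less
    then have "t ^ m = - ((- t) ^ m)" using assms by simp
    then show ?thesis using less pos[of "- t"] by (simp add: odd_pow_def real_root_minus)
  qed (use m pos in \<open>auto simp: odd_pow_def power_0_left\<close>)
qed

(* A sequence indexed by the integers from some point on is a total function
   whose values before that point are ignored. *)
definition is_solution ::
  "nat \<Rightarrow> nat \<Rightarrow> int \<Rightarrow> int \<Rightarrow> (int \<Rightarrow> real) \<Rightarrow> (int \<Rightarrow> real) \<Rightarrow> (int \<Rightarrow> real) \<Rightarrow> bool"
  where "is_solution m n \<sigma> \<zeta>0 r q x \<longleftrightarrow>
    (\<exists>\<zeta>\<ge>\<zeta>0 - \<sigma>. x \<zeta> \<noteq> 0) \<and>
    (\<forall>\<zeta>\<ge>\<zeta>0. \<Delta> (\<lambda>\<xi>. r \<xi> * odd_pow m n (\<Delta> x \<xi>)) \<zeta> + q \<zeta> * odd_pow m n (x (\<zeta> - \<sigma>)) = 0)"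

definition oscillates :: "(int \<Rightarrow> real) \<Rightarrow> bool"
  where "oscillates x \<longleftrightarrow>
    \<not> (\<forall>\<^sub>F \<zeta> in at_top. x \<zeta> > 0) \<and> \<not> (\<forall>\<^sub>F \<zeta> in at_top. x \<zeta> < 0)"

end

theory Submission
  imports Defs
begin

text \<open>
  Put \<open>y = r (\<Delta> x)\<^sup>\<alpha>\<close> and \<open>Q(\<zeta>) = q(\<zeta>0) + \<dots> + q(\<zeta> - 1)\<close>. By the symmetry \<open>x \<mapsto> - x\<close> it
  suffices to treat an eventually positive solution. For such an \<open>x\<close> the equation makes
  \<open>y\<close> eventually nonincreasing, so \<open>y\<close>, and with it \<open>\<Delta> x\<close>, eventually has a constant sign, and
  \<open>x\<close> is eventually monotone. A positive, eventually monotone sequence that does not tend to \<open>0\<close>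
  stays above some constant \<open>c > 0\<close>; the proof shows that no solution does.

  The two series conditions together force \<open>Q(\<zeta>) \<rightarrow> \<infinity>\<close>
  (lemma \<open>partial_sums_unbounded\<close>): a bound on \<open>Q\<close> would make a constant multiple of
  the convergent series dominate the divergent one. If now \<open>x \<ge> c > 0\<close> eventually, then
  \<open>\<Delta> y \<le> - c\<^sup>\<alpha> q\<close>, hence \<open>y \<le> K - c\<^sup>\<alpha> Q\<close> for some constant \<open>K\<close>, and because
  \<open>Q \<rightarrow> \<infinity>\<close> the constant is absorbed: \<open>y \<le> - (c\<^sup>\<alpha> / 2) Q\<close> from some point on. Solving for
  \<open>\<Delta> x\<close> bounds it above by a negative multiple of \<open>(Q / r)\<^sup>1\<^sup>/\<^sup>\<alpha>\<close>, the term of the divergent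
  series, so \<open>x \<rightarrow> - \<infinity>\<close>, which is absurd (lemma \<open>no_positive_lower_bound\<close>). This one
  argument excludes both the nondecreasing solutions and the nonincreasing solutions with a
  positive limit.
\<close>

section \<open>Odd power functions\<close>

lemma odd_pow_mono: "odd m \<Longrightarrow> odd n \<Longrightarrow> s \<le> t \<Longrightarrow> odd_pow m n s \<le> odd_pow m n t"
  by (simp add: odd_pow_def odd_pos power_mono_odd)

lemma odd_pow_mult: "odd_pow m n (s * t) = odd_pow m n s * odd_pow m n t"
  by (simp add: odd_pow_def power_mult_distrib real_root_mult)

lemma odd_pow_divide: "odd_pow m n (s / t) = odd_pow m n s / odd_pow m n t"
  by (simp add: odd_pow_def power_divide real_root_divide)

lemma odd_pow_minus: "odd m \<Longrightarrow> odd_pow m n (- t) = - odd_pow m n t"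
  by (simp add: odd_pow_def real_root_minus)

lemma odd_pow_0: "odd m \<Longrightarrow> odd_pow m n 0 = 0"
  by (auto simp: odd_pow_def power_0_left)

lemma odd_pow_pos: "odd n \<Longrightarrow> t > 0 \<Longrightarrow> odd_pow m n t > 0"
  by (simp add: odd_pow_def odd_pos)

lemma odd_pow_inverse:
  assumes "odd m" "odd n"
  shows "odd_pow n m (odd_pow m n t) = t"
  using assms by (simp add: odd_pow_def odd_real_root_pow odd_real_root_power_cancel)


section \<open>Sequences and sums indexed by integers\<close>

lemma antimono_from:
  fixes f :: "int \<Rightarrow> real"
  assumes step: "\<And>\<zeta>. \<zeta> \<ge> T \<Longrightarrow> f (\<zeta> + 1) \<le> f \<zeta>" and "T \<le> a" "a \<le> b"
  shows "f b \<le> f a"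
  using \<open>a \<le> b\<close>
proof (induction b rule: int_ge_induct)
  case (step b)
  then show ?case using assms(1)[of b] \<open>T \<le> a\<close> by linarith
qed simp

lemma sum_int_interval_Suc:
  fixes f :: "int \<Rightarrow> real"
  assumes "a \<le> b + 1"
  shows "(\<Sum>s=a..b + 1. f s) = (\<Sum>s=a..b. f s) + f (b + 1)"
proof -
  have "{a..b + 1} = insert (b + 1) {a..b}" using assms by auto
  then show ?thesis by simp
qed

lemma sum_int_interval_eq_nat:
  fixes f :: "int \<Rightarrow> real"
  shows "(\<Sum>s=a..b. f s) = (\<Sum>k<nat (b + 1 - a). f (a + int k))"
  by (rule sum.reindex_bij_witness[where i="\<lambda>k. a + int k" and j="\<lambda>s. nat (s - a)"]) auto

lemma sum_int_interval_mono:
  fixes f :: "int \<Rightarrow> real"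
  assumes "\<And>s. s \<ge> a \<Longrightarrow> f s \<ge> 0" "b \<le> b'"
  shows "(\<Sum>s=a..b. f s) \<le> (\<Sum>s=a..b'. f s)"
  using assms by (intro sum_mono2) auto


section \<open>The coefficients\<close>

text \<open>
  A bound \<open>B\<close> on the partial sums of \<open>q\<close> would bound the divergent series by
  \<open>B\<^sup>1\<^sup>/\<^sup>\<alpha> \<Sum> r\<^sup>-\<^sup>1\<^sup>/\<^sup>\<alpha> < \<infinity>\<close>.
\<close>
lemma partial_sums_unbounded:
  fixes r q :: "int \<Rightarrow> real"
  assumes "odd m" "odd n"
    and r: "\<And>\<zeta>. \<zeta> \<ge> \<zeta>0 \<Longrightarrow> r \<zeta> > 0"
    and q: "\<And>\<zeta>. \<zeta> \<ge> \<zeta>0 \<Longrightarrow> q \<zeta> \<ge> 0"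
    and summ: "summable (\<lambda>k. 1 / odd_pow n m (r (\<zeta>0 + int k)))"
    and div: "filterlim (\<lambda>N. \<Sum>\<zeta>=\<zeta>0..N. odd_pow n m (1 / r \<zeta> * (\<Sum>s=\<zeta>0..\<zeta> - 1. q s))) at_top at_top"
  shows "filterlim (\<lambda>\<zeta>. \<Sum>s=\<zeta>0..\<zeta> - 1. q s) at_top at_top"
proof -
  define Q where "Q = (\<lambda>\<zeta>. \<Sum>s=\<zeta>0..\<zeta> - 1. q s)"
  define h where "h = (\<lambda>\<zeta>. 1 / odd_pow n m (r \<zeta>))"
  have Q_mono: "Q a \<le> Q b" if "a \<le> b" for a b
    unfolding Q_def using that by (intro sum_int_interval_mono q) auto
  have h_nonneg: "h \<zeta> \<ge> 0" if "\<zeta> \<ge> \<zeta>0" for \<zeta>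
    unfolding h_def using odd_pow_pos[OF \<open>odd m\<close> r[OF that], of n] by simp
  have "\<exists>a. B < Q a" for B
  proof (rule ccontr)
    assume "\<not> (\<exists>a. B < Q a)"
    then have B: "Q a \<le> B" for a by (simp add: not_less)
    define M where "M = odd_pow n m B * (\<Sum>k. h (\<zeta>0 + int k))"
    have "B \<ge> 0" using B[of \<zeta>0] by (simp add: Q_def)
    then have oB: "odd_pow n m B \<ge> 0"
      using odd_pow_mono[of n m 0 B] odd_pow_0[of n m] assms(1,2) by simp
    have "(\<Sum>\<zeta>=\<zeta>0..N. odd_pow n m (1 / r \<zeta> * Q \<zeta>)) \<le> M" for N
    proof -
      have "odd_pow n m (1 / r \<zeta> * Q \<zeta>) \<le> odd_pow n m B * h \<zeta>" if "\<zeta> \<ge> \<zeta>0" for \<zeta>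
      proof -
        have "1 / r \<zeta> * Q \<zeta> \<le> B / r \<zeta>"
          using B[of \<zeta>] r[OF that] by (simp add: divide_right_mono)
        then have "odd_pow n m (1 / r \<zeta> * Q \<zeta>) \<le> odd_pow n m (B / r \<zeta>)"
          using odd_pow_mono assms(1,2) by blast
        then show ?thesis by (simp add: odd_pow_divide h_def)
      qed
      then have "(\<Sum>\<zeta>=\<zeta>0..N. odd_pow n m (1 / r \<zeta> * Q \<zeta>)) \<le> odd_pow n m B * (\<Sum>\<zeta>=\<zeta>0..N. h \<zeta>)"
        unfolding sum_distrib_left by (intro sum_mono) auto
      also have "\<dots> \<le> M"
        unfolding M_def sum_int_interval_eq_nat
        using summ h_nonneg oB by (intro mult_left_mono sum_le_suminf) (auto simp: h_def)
      finally show ?thesis .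
    qed
    moreover have "\<forall>\<^sub>F N in at_top. M < (\<Sum>\<zeta>=\<zeta>0..N. odd_pow n m (1 / r \<zeta> * Q \<zeta>))"
      using div unfolding filterlim_at_top_dense Q_def by blast
    then obtain N where "M < (\<Sum>\<zeta>=\<zeta>0..N. odd_pow n m (1 / r \<zeta> * Q \<zeta>))"
      unfolding eventually_at_top_linorder by blast
    ultimately show False by (meson not_less)
  qed
  then have "\<forall>\<^sub>F \<zeta> in at_top. B < Q \<zeta>" for B
    unfolding eventually_at_top_linorder using Q_mono by (meson less_le_trans)
  then show ?thesis by (simp add: filterlim_at_top_dense Q_def)
qed


section \<open>Behaviour of solutions\<close>

lemma is_solution_uminus:
  assumes "odd m" "is_solution m n \<sigma> \<zeta>0 r q x"
  shows "is_solution m n \<sigma> \<zeta>0 r q (\<lambda>\<zeta>. - x \<zeta>)"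
proof -
  have diff: "\<Delta> (\<lambda>\<zeta>. - f \<zeta>) = (\<lambda>\<zeta>. - \<Delta> f \<zeta>)" for f by (auto simp: fdiff_def)
  have "\<Delta> (\<lambda>\<xi>. r \<xi> * odd_pow m n (\<Delta> (\<lambda>\<zeta>. - x \<zeta>) \<xi>)) \<zeta> + q \<zeta> * odd_pow m n (- x (\<zeta> - \<sigma>))
    = - (\<Delta> (\<lambda>\<xi>. r \<xi> * odd_pow m n (\<Delta> x \<xi>)) \<zeta> + q \<zeta> * odd_pow m n (x (\<zeta> - \<sigma>)))" for \<zeta>
    unfolding diff odd_pow_minus[OF \<open>odd m\<close>] by (simp add: fdiff_def)
  with assms(2) show ?thesis unfolding is_solution_def by (metis neg_0_equal_iff_equal)
qed

text \<open>
  The quantity \<open>r (\<Delta> x)\<^sup>\<alpha> + c\<^sup>\<alpha> Q\<close> is nonincreasing as long as \<open>x(\<zeta> - \<sigma>) \<ge> c\<close>, since the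
  decrease \<open>q x\<^sup>\<alpha>\<close> of the first term outweighs the increase \<open>c\<^sup>\<alpha> q\<close> of the second. As \<open>Q\<close>
  tends to infinity, the first term is driven below \<open>- (c\<^sup>\<alpha> / 2) Q\<close>, and \<open>x\<close> falls at least as
  fast as a multiple of the divergent series grows.
\<close>
lemma no_positive_lower_bound:
  fixes r q :: "int \<Rightarrow> real"
  assumes "odd m" "odd n"
    and r: "\<And>\<zeta>. \<zeta> \<ge> \<zeta>0 \<Longrightarrow> r \<zeta> > 0"
    and q: "\<And>\<zeta>. \<zeta> \<ge> \<zeta>0 \<Longrightarrow> q \<zeta> \<ge> 0"
    and Q_top: "filterlim (\<lambda>\<zeta>. \<Sum>s=\<zeta>0..\<zeta> - 1. q s) at_top at_top"
    and div: "filterlim (\<lambda>N. \<Sum>\<zeta>=\<zeta>0..N. odd_pow n m (1 / r \<zeta> * (\<Sum>s=\<zeta>0..\<zeta> - 1. q s))) at_top at_top"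
    and sol: "is_solution m n \<sigma> \<zeta>0 r q x"
    and "c > 0"
  shows "\<not> (\<forall>\<^sub>F \<zeta> in at_top. c \<le> x \<zeta>)"
proof
  assume "\<forall>\<^sub>F \<zeta> in at_top. c \<le> x \<zeta>"
  then obtain T0 where T0: "\<And>\<zeta>. \<zeta> \<ge> T0 \<Longrightarrow> c \<le> x \<zeta>"
    by (auto simp: eventually_at_top_linorder)
  define T where "T = max \<zeta>0 (max T0 (T0 + \<sigma>))"
  define y where "y = (\<lambda>\<zeta>. r \<zeta> * odd_pow m n (\<Delta> x \<zeta>))"
  define Q where "Q = (\<lambda>\<zeta>. \<Sum>s=\<zeta>0..\<zeta> - 1. q s)"
  define C where "C = odd_pow m n c"
  have "C > 0" unfolding C_def using odd_pow_pos[OF \<open>odd n\<close> \<open>c > 0\<close>] .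
  have y_step: "y (\<zeta> + 1) + C * Q (\<zeta> + 1) \<le> y \<zeta> + C * Q \<zeta>" if "\<zeta> \<ge> T" for \<zeta>
  proof -
    have ge: "\<zeta> \<ge> \<zeta>0" "c \<le> x (\<zeta> - \<sigma>)" using that T0 by (auto simp: T_def)
    have "y (\<zeta> + 1) - y \<zeta> = - q \<zeta> * odd_pow m n (x (\<zeta> - \<sigma>))"
      using sol ge(1) unfolding is_solution_def fdiff_def y_def by fastforce
    moreover have "q \<zeta> * C \<le> q \<zeta> * odd_pow m n (x (\<zeta> - \<sigma>))"
      unfolding C_def using odd_pow_mono[OF assms(1,2) ge(2)] q[OF ge(1)] by (rule mult_left_mono)
    moreover have "Q (\<zeta> + 1) = Q \<zeta> + q \<zeta>"
      using sum_int_interval_Suc[of \<zeta>0 "\<zeta> - 1" q] ge(1) by (simp add: Q_def)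
    ultimately show ?thesis by (simp add: algebra_simps)
  qed
  define K where "K = y T + C * Q T"
  have y_le: "y \<zeta> \<le> K - C * Q \<zeta>" if "\<zeta> \<ge> T" for \<zeta>
    using antimono_from[where f="\<lambda>\<zeta>. y \<zeta> + C * Q \<zeta>" and T=T and a=T and b=\<zeta>] y_step that
    by (auto simp: K_def)
  \<comment> \<open>Past \<open>Q = 2 K / C\<close>, half of \<open>C Q\<close> absorbs the constant \<open>K\<close>.\<close>
  obtain T1 where T1: "\<And>\<zeta>. \<zeta> \<ge> T1 \<Longrightarrow> 2 * K / C \<le> Q \<zeta>"
    using Q_top unfolding filterlim_at_top eventually_at_top_linorder Q_def by blast
  define S where "S = max T T1"
  define g where "g = (\<lambda>\<zeta>. odd_pow n m (1 / r \<zeta> * Q \<zeta>))"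
  define k where "k = odd_pow n m (C / 2)"
  have "k > 0" unfolding k_def using odd_pow_pos[of m "C / 2"] \<open>odd m\<close> \<open>C > 0\<close> by simp
  have x_step: "\<Delta> x \<zeta> \<le> - (k * g \<zeta>)" if "\<zeta> \<ge> S" for \<zeta>
  proof -
    have ge: "\<zeta> \<ge> T" "\<zeta> \<ge> T1" "r \<zeta> > 0" using that r by (auto simp: S_def T_def)
    have "K \<le> C / 2 * Q \<zeta>" using T1[OF ge(2)] \<open>C > 0\<close> by (simp add: field_simps)
    then have "y \<zeta> \<le> - (C / 2 * Q \<zeta>)" using y_le[OF ge(1)] by simp
    then have "y \<zeta> / r \<zeta> \<le> - (C / 2 * Q \<zeta>) / r \<zeta>" using ge(3) by (intro divide_right_mono) auto
    then have "odd_pow m n (\<Delta> x \<zeta>) \<le> - (C / 2 * (1 / r \<zeta> * Q \<zeta>))"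
      using ge(3) by (simp add: y_def)
    then have "odd_pow n m (odd_pow m n (\<Delta> x \<zeta>)) \<le> odd_pow n m (- (C / 2 * (1 / r \<zeta> * Q \<zeta>)))"
      by (rule odd_pow_mono[OF assms(2,1)])
    then show ?thesis
      unfolding odd_pow_inverse[OF assms(1,2)] odd_pow_minus[OF \<open>odd n\<close>]
      by (simp only: odd_pow_mult[of n m "C / 2"] k_def g_def)
  qed
  define A where "A = (\<lambda>N. \<Sum>\<zeta>=\<zeta>0..N. g \<zeta>)"
  have A_step: "x (\<zeta> + 1 + 1) + k * A (\<zeta> + 1) \<le> x (\<zeta> + 1) + k * A \<zeta>" if "\<zeta> \<ge> S" for \<zeta>
  proof -
    have "A (\<zeta> + 1) = A \<zeta> + g (\<zeta> + 1)"
      unfolding A_def using that by (intro sum_int_interval_Suc) (auto simp: S_def T_def)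
    then show ?thesis using x_step[of "\<zeta> + 1"] that by (simp add: fdiff_def algebra_simps)
  qed
  define L where "L = x (S + 1) + k * A S"
  have A_bound: "A \<zeta> \<le> L / k" if "\<zeta> \<ge> S" for \<zeta>
  proof -
    have "x (\<zeta> + 1) + k * A \<zeta> \<le> L"
      using antimono_from[where f="\<lambda>\<zeta>. x (\<zeta> + 1) + k * A \<zeta>" and T=S and a=S and b=\<zeta>] A_step that
      by (auto simp: L_def)
    moreover have "x (\<zeta> + 1) > 0"
      using T0[of "\<zeta> + 1"] that \<open>c > 0\<close> by (auto simp: S_def T_def)
    ultimately show ?thesis using \<open>k > 0\<close> by (simp add: field_simps)
  qed
  have "\<forall>\<^sub>F N in at_top. L / k < A N"
    using div unfolding filterlim_at_top_dense A_def g_def Q_def by blast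
  then obtain N where "\<And>\<zeta>. \<zeta> \<ge> N \<Longrightarrow> L / k < A \<zeta>"
    by (auto simp: eventually_at_top_linorder)
  then show False using A_bound[of "max N S"] by (meson max.cobounded1 max.cobounded2 not_less)
qed

text \<open>
  Positivity of \<open>x\<close> makes \<open>r (\<Delta> x)\<^sup>\<alpha>\<close> eventually nonincreasing, so \<open>x\<close> is eventually monotone.
  A positive sequence that is eventually nondecreasing would have a positive lower bound. Hence
  \<open>x\<close> is eventually nonincreasing, and the lack of a positive lower bound makes its limit \<open>0\<close>.
\<close>
lemma eventually_positive_solution_tendsto_0:
  fixes r q :: "int \<Rightarrow> real"
  assumes "odd m" "odd n"
    and r: "\<And>\<zeta>. \<zeta> \<ge> \<zeta>0 \<Longrightarrow> r \<zeta> > 0"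
    and q: "\<And>\<zeta>. \<zeta> \<ge> \<zeta>0 \<Longrightarrow> q \<zeta> \<ge> 0"
    and sol: "is_solution m n \<sigma> \<zeta>0 r q x"
    and pos: "\<forall>\<^sub>F \<zeta> in at_top. x \<zeta> > 0"
    and no_bound: "\<And>c. c > 0 \<Longrightarrow> \<not> (\<forall>\<^sub>F \<zeta> in at_top. c \<le> x \<zeta>)"
  shows "(x \<longlongrightarrow> 0) at_top"
proof -
  obtain T0 where T0: "\<And>\<zeta>. \<zeta> \<ge> T0 \<Longrightarrow> x \<zeta> > 0"
    using pos by (auto simp: eventually_at_top_linorder)
  define T where "T = max \<zeta>0 (max T0 (T0 + \<sigma>))"
  have T_ge: "T \<ge> T0" by (simp add: T_def)
  define y where "y = (\<lambda>\<zeta>. r \<zeta> * odd_pow m n (\<Delta> x \<zeta>))"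
  have y_step: "y (\<zeta> + 1) \<le> y \<zeta>" if "\<zeta> \<ge> T" for \<zeta>
  proof -
    have ge: "\<zeta> \<ge> \<zeta>0" "x (\<zeta> - \<sigma>) > 0" using that T0 by (auto simp: T_def)
    have "y (\<zeta> + 1) - y \<zeta> = - (q \<zeta> * odd_pow m n (x (\<zeta> - \<sigma>)))"
      using sol ge(1) unfolding is_solution_def fdiff_def y_def by fastforce
    moreover have "q \<zeta> * odd_pow m n (x (\<zeta> - \<sigma>)) \<ge> 0"
      using q[OF ge(1)] odd_pow_pos[OF \<open>odd n\<close> ge(2), of m] by simp
    ultimately show ?thesis by simp
  qed
  have sgn: "\<Delta> x \<zeta> \<ge> 0 \<longleftrightarrow> y \<zeta> \<ge> 0" if "\<zeta> \<ge> T" for \<zeta>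
  proof -
    have "r \<zeta> > 0" using that r by (simp add: T_def)
    moreover have "odd_pow m n (\<Delta> x \<zeta>) \<ge> 0 \<longleftrightarrow> \<Delta> x \<zeta> \<ge> 0"
      using \<open>odd m\<close> \<open>odd n\<close> by (simp add: odd_pow_def odd_pos zero_le_odd_power)
    ultimately show ?thesis by (simp add: y_def zero_le_mult_iff)
  qed
  have "\<not> (\<forall>\<zeta>\<ge>T. y \<zeta> \<ge> 0)"
  proof
    assume "\<forall>\<zeta>\<ge>T. y \<zeta> \<ge> 0"
    then have "- x (\<zeta> + 1) \<le> - x \<zeta>" if "\<zeta> \<ge> T" for \<zeta>
      using sgn that by (simp add: fdiff_def)
    then have "x T \<le> x \<zeta>" if "\<zeta> \<ge> T" for \<zeta>
      using antimono_from[where f="\<lambda>\<zeta>. - x \<zeta>" and T=T and a=T and b=\<zeta>] that by auto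
    then show False
      using no_bound[of "x T"] T0[of T] T_ge unfolding eventually_at_top_linorder by blast
  qed
  then obtain S where S: "S \<ge> T" "y S < 0" by force
  have x_step: "x (\<zeta> + 1) \<le> x \<zeta>" if "\<zeta> \<ge> S" for \<zeta>
  proof -
    have "y \<zeta> \<le> y S" using antimono_from[of T y S \<zeta>] y_step S(1) that by auto
    then show ?thesis using sgn[of \<zeta>] S that by (simp add: fdiff_def)
  qed
  show ?thesis
  proof (rule order_tendstoI)
    fix a :: real assume "a < 0"
    then show "\<forall>\<^sub>F \<zeta> in at_top. a < x \<zeta>" using pos by (auto elim: eventually_mono)
  next
    fix a :: real assume "0 < a"
    obtain N where N: "N \<ge> S" "x N < a"
      using no_bound[OF \<open>0 < a\<close>] by (force simp: eventually_at_top_linorder)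
    have "x \<zeta> < a" if "\<zeta> \<ge> N" for \<zeta>
      using antimono_from[of S x N \<zeta>] x_step N that by fastforce
    then show "\<forall>\<^sub>F \<zeta> in at_top. x \<zeta> < a" by (auto simp: eventually_at_top_linorder)
  qed
qed

theorem theorem2p1:
  fixes m n :: nat and \<sigma> \<zeta>0 :: int and r q :: "int \<Rightarrow> real"
  assumes "odd m" and "odd n" and "coprime m n"
    and "\<sigma> \<ge> 0"
    and "\<And>\<zeta>. \<zeta> \<ge> \<zeta>0 \<Longrightarrow> r \<zeta> > 0"
    and "\<And>\<zeta>. \<zeta> \<ge> \<zeta>0 \<Longrightarrow> q \<zeta> \<ge> 0"
    and "infinite {\<zeta>. \<zeta> \<ge> \<zeta>0 \<and> q \<zeta> \<noteq> 0}"
    and "summable (\<lambda>k. 1 / odd_pow n m (r (\<zeta>0 + int k)))"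
    and "filterlim (\<lambda>N. \<Sum>\<zeta>=\<zeta>0..N. odd_pow n m (1 / r \<zeta> * (\<Sum>s=\<zeta>0..\<zeta> - 1. q s))) at_top at_top"
  shows "\<forall>x. is_solution m n \<sigma> \<zeta>0 r q x \<longrightarrow> oscillates x \<or> (x \<longlongrightarrow> 0) at_top"
proof (intro allI impI)
  fix x assume sol: "is_solution m n \<sigma> \<zeta>0 r q x"
  have Q_top: "filterlim (\<lambda>\<zeta>. \<Sum>s=\<zeta>0..\<zeta> - 1. q s) at_top at_top"
    by (rule partial_sums_unbounded) (use assms in auto)
  have positive: "(z \<longlongrightarrow> 0) at_top"
    if z: "is_solution m n \<sigma> \<zeta>0 r q z" "\<forall>\<^sub>F \<zeta> in at_top. z \<zeta> > 0" for z
    using assms(1,2,5,6) z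
  proof (rule eventually_positive_solution_tendsto_0)
    show "\<not> (\<forall>\<^sub>F \<zeta> in at_top. c \<le> z \<zeta>)" if "c > 0" for c
      using assms(1,2,5,6) Q_top assms(9) z(1) that by (rule no_positive_lower_bound)
  qed
  consider "oscillates x" | "\<forall>\<^sub>F \<zeta> in at_top. x \<zeta> > 0" | "\<forall>\<^sub>F \<zeta> in at_top. - x \<zeta> > 0"
    by (auto simp: oscillates_def)
  then show "oscillates x \<or> (x \<longlongrightarrow> 0) at_top"
  proof cases
    case 3
    have "((\<lambda>\<zeta>. - x \<zeta>) \<longlongrightarrow> 0) at_top"
      using is_solution_uminus[OF \<open>odd m\<close> sol] 3 by (rule positive)
    then show ?thesis using tendsto_minus_cancel_left[of x 0] by simp
  qed (use positive sol in auto)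
qed

end
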